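(* For any $\Theta$ satisfying $\textsf{SFF}(\Theta)$, there are more functions of type one computable in $\Theta$ and $\exists^2$ than just in $\exists^2$; that is, there is a function $f:\mathbb{N}\to\mathbb{N}$ which is computable in $\Theta$ and $\exists^2$ together, but which is not computable in $\exists^2$.
   Context: The metatheory is $\textsf{ZFC}$ and functionals live in the full (set-theoretic) type structure over $\mathbb{N}$. "Computable" (in given functionals) means Kleene computable via the schemes S1–S9. For $f\in\mathbb{N}^{\mathbb{N}}$, $\overline{f}N=\langle f(0),\dots,f(N-1)\rangle$; for a finite sequence $\sigma$, $f\in[\sigma]$ means $f$ extends $\sigma$. A functional $\Theta$ of type $2\to1^*$ assigns to every $G:\mathbb{N}^{\mathbb{N}}\to\mathbb{N}$ a finite sequence $\Theta(G)=\langle f_0,\dots,f_k\rangle$ of elements of $\mathbb{N}^{\mathbb{N}}$ (as an oracle, it provides the length of $\Theta(G)$ and the values $\Theta(G)(i)(n)$). $\textsf{SFF}(\Theta)$ ("$\Theta$ is a special fan functional") is the statement: for all $G:\mathbb{N}^{\mathbb{N}}\to\mathbb{N}$ and all $f\in2^{\mathbb{N}}$ there is an entry $g$ of $\Theta(G)$ with $f\in[\overline{g}G(g)]$. $\exists^2:\mathbb{N}^{\mathbb{N}}\to\{0,1\}$ is the functional with $\exists^2(f)=0$ if and only if $(\exists n)(f(n)=0)$. *)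

theory Defs
  imports Main "HOL-Library.Nat_Bijection"
begin

type_synonym ty1 = "nat \<Rightarrow> nat"
type_synonym ty2 = "ty1 \<Rightarrow> nat"
type_synonym ty2to1s = "ty2 \<Rightarrow> ty1 list"

definition init_seg :: "ty1 \<Rightarrow> nat \<Rightarrow> nat list" where
  "init_seg f N = map f [0..<N]"

definition nbhd :: "nat list \<Rightarrow> ty1 set" where
  "nbhd \<sigma> = {f. init_seg f (length \<sigma>) = \<sigma>}"

definition SFF :: "ty2to1s \<Rightarrow> bool" where
  "SFF \<Theta> \<longleftrightarrow>
     (\<forall>G. \<forall>f. range f \<subseteq> {0, 1} \<longrightarrow> (\<exists>g \<in> set (\<Theta> G). f \<in> nbhd (init_seg g (G g))))"

definition exists2 :: ty2 where
  "exists2 f = (if \<exists>n. f n = 0 then 0 else 1)"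

definition to_front :: "nat \<Rightarrow> 'a list \<Rightarrow> 'a list" where
  "to_front k xs = xs ! k # take k xs @ drop (Suc k) xs"

text \<open>
  Kleene's schemes S1--S9: \<open>kleene Fs Ts e ns fs v\<close> says that \<open>{e}(ns, fs, Fs, Ts)\<close> is defined
  with value \<open>v\<close>. The argument list is split into blocks by type, as in Kleene's convention that
  only the order among arguments of the same type matters:
  \<open>ns\<close> of type 0, \<open>fs\<close> of type 1, \<open>Fs\<close> of type 2, \<open>Ts\<close> of type \<open>2 \<rightarrow> 1*\<close>.
  No scheme introduces arguments of the last two types, so these blocks are fixed parameters, and
  S8 selects an entry by its position instead of having S6 move it to the front.

  S8 for type 2 requires the function fed to the functional to be total. An argument \<open>\<Theta>\<close> of
  type \<open>2 \<rightarrow> 1*\<close> has two instances of S8, again only for a total \<open>G\<close>: one returns the length of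
  \<open>\<Theta>(G)\<close>, the other returns \<open>\<Theta>(G)(i)(n)\<close>, which is undefined unless \<open>i\<close> is below that length.

  Indices are numbers, as S9 demands; \<open>list_encode\<close> is the standard computable coding of finite
  sequences. In S9, the \<open>m\<close> and \<open>l\<close> in the index give the numbers of arguments of type 0 and 1 that
  are passed on; the others are discarded.
\<close>

inductive kleene ::
  "ty2 list \<Rightarrow> ty2to1s list \<Rightarrow> nat \<Rightarrow> nat list \<Rightarrow> ty1 list \<Rightarrow> nat \<Rightarrow> bool"
  for Fs :: "ty2 list" and Ts :: "ty2to1s list" where
  S1: "kleene Fs Ts (list_encode [1]) (x # ns) fs (Suc x)"
| S2: "kleene Fs Ts (list_encode [2, q]) ns fs q"
| S3: "kleene Fs Ts (list_encode [3]) (x # ns) fs x"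
| S4: "kleene Fs Ts h ns fs y \<Longrightarrow> kleene Fs Ts g (y # ns) fs z
        \<Longrightarrow> kleene Fs Ts (list_encode [4, g, h]) ns fs z"
| S5_0: "kleene Fs Ts g ns fs z
        \<Longrightarrow> kleene Fs Ts (list_encode [5, g, h]) (0 # ns) fs z"
| S5_Suc: "kleene Fs Ts (list_encode [5, g, h]) (x # ns) fs y
        \<Longrightarrow> kleene Fs Ts h (x # y # ns) fs z
        \<Longrightarrow> kleene Fs Ts (list_encode [5, g, h]) (Suc x # ns) fs z"
| S6_0: "k < length ns \<Longrightarrow> kleene Fs Ts g (to_front k ns) fs z
        \<Longrightarrow> kleene Fs Ts (list_encode [6, 0, k, g]) ns fs z"
| S6_1: "k < length fs \<Longrightarrow> kleene Fs Ts g ns (to_front k fs) z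
        \<Longrightarrow> kleene Fs Ts (list_encode [6, 1, k, g]) ns fs z"
| S7: "kleene Fs Ts (list_encode [7]) (x # ns) (f # fs) (f x)"
| S8_2: "k < length Fs \<Longrightarrow> (\<forall>x. kleene Fs Ts d (x # ns) fs (\<phi> x))
        \<Longrightarrow> kleene Fs Ts (list_encode [8, 0, k, d]) ns fs ((Fs ! k) \<phi>)"
| S8_len: "k < length Ts \<Longrightarrow> (\<forall>f. kleene Fs Ts d ns (f # fs) (G f))
        \<Longrightarrow> kleene Fs Ts (list_encode [8, 1, k, d]) ns fs (length ((Ts ! k) G))"
| S8_val: "k < length Ts \<Longrightarrow> (\<forall>f. kleene Fs Ts d ns (f # fs) (G f))
        \<Longrightarrow> i < length ((Ts ! k) G)
        \<Longrightarrow> kleene Fs Ts (list_encode [8, 2, k, d]) (i # n # ns) fs (((Ts ! k) G ! i) n)"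
| S9: "m \<le> length ns \<Longrightarrow> l \<le> length fs \<Longrightarrow> kleene Fs Ts x (take m ns) (take l fs) z
        \<Longrightarrow> kleene Fs Ts (list_encode [9, m, l]) (x # ns) fs z"

definition computable_in :: "ty2 list \<Rightarrow> ty2to1s list \<Rightarrow> ty1 \<Rightarrow> bool" where
  "computable_in Fs Ts f \<longleftrightarrow> (\<exists>e. \<forall>n. kleene Fs Ts e [n] [] (f n))"

end

theory Submission
  imports Defs
begin

text \<open>
  The function \<open>d\<close> computed from \<open>\<Theta>\<close> and \<open>\<exists>\<^sup>2\<close> differs at every \<open>n\<close> from the value of \<open>{n}(n)\<close> in
  \<open>\<exists>\<^sup>2\<close>, if there is one. A binary function is read as a list of claims "the computation \<open>t\<close> has the
  value \<open>v\<close>". Given such an \<open>f\<close> and a computation \<open>r\<close>, follow \<open>f\<close> from \<open>r\<close> downwards through the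
  subcomputations, passing from the first to the second subcomputation of a composition only if
  everything below the first is locally correct. If \<open>r\<close> converges, then all computations visited
  converge, so either \<open>f\<close> is right about \<open>r\<close> or there is a visited computation at which \<open>f\<close> is locally
  wrong although it is correct everywhere below; there \<open>f\<close> differs from the truth. Put \<open>G(f)\<close> above
  the position of such an error. This is arithmetical in \<open>f\<close>, hence \<open>G\<close> is total and computable in
  \<open>\<exists>\<^sup>2\<close>. As \<open>\<Theta>(G)\<close> covers the set of true claims, one of its finitely many entries is right about \<open>r\<close>,
  and \<open>d(n)\<close> is chosen to avoid the least values that the entries claim for \<open>{n}(n)\<close>.
\<close>

section \<open>Programming with S1--S9\<close>

declare list_encode.simps [simp del]

section \<open>Computable total functions and their composition\<close>

definition kfun :: "ty2to1s list \<Rightarrow> nat \<Rightarrow> nat \<Rightarrow> (nat list \<Rightarrow> ty1 list \<Rightarrow> nat) \<Rightarrow> bool" where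
  "kfun Ts k l F \<longleftrightarrow> (\<exists>e. \<forall>ns fs. length ns = k \<longrightarrow> length fs = l \<longrightarrow> kleene [exists2] Ts e ns fs (F ns fs))"

text \<open>Truth is coded by 0, so that \<open>exists2\<close> itself acts as the number quantifier
  and the base case of S5 is the branch taken when \<open>P\<close> holds.\<close>

definition kpred :: "ty2to1s list \<Rightarrow> nat \<Rightarrow> nat \<Rightarrow> (nat list \<Rightarrow> ty1 list \<Rightarrow> bool) \<Rightarrow> bool" where
  "kpred Ts k l P \<longleftrightarrow> kfun Ts k l (\<lambda>ns fs. if P ns fs then 0 else 1)"

text \<open>No scheme depends on where the number block ends: S6 moves an entry at an existing
  position and S9 passes on a prefix. So values left over behind the arguments do no harm.\<close>

lemma kleene_append: "kleene Fs Ts e ns fs v \<Longrightarrow> kleene Fs Ts e (ns @ ms) fs v"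
proof (induction rule: kleene.induct)
  case (S6_0 k ns g fs z)
  then have "kleene Fs Ts g (to_front k (ns @ ms)) fs z"
    by (simp add: to_front_def nth_append)
  with S6_0 show ?case by (auto intro: kleene.S6_0)
next
  case (S9 m ns l fs x z)
  have "kleene Fs Ts x (take m (ns @ ms)) (take l fs) z" using S9.hyps by simp
  with S9 show ?case by (auto intro!: kleene.S9)
qed (auto simp del: One_nat_def intro: kleene.intros)

lemma kfun_cong:
  assumes "kfun Ts k l F"
    and "\<And>ns fs. length ns = k \<Longrightarrow> length fs = l \<Longrightarrow> F ns fs = F' ns fs"
  shows "kfun Ts k l F'"
  using assms unfolding kfun_def by metis

text \<open>S4 pushes intermediate values \<open>acc\<close> in front of the arguments. To evaluate
  another function, the arguments are copied to the front again, the last one first;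
  \<open>C\<close> acts on indices alone, uniformly in the data.\<close>

lemma copy_args:
  assumes "i \<le> k"
  shows "\<exists>C. \<forall>e acc ns fs v. length acc = j \<longrightarrow> length ns = k \<longrightarrow>
    kleene Fs Ts e (drop (k - i) ns @ acc @ ns) fs v \<longrightarrow> kleene Fs Ts (C e) (acc @ ns) fs v"
  using assms
proof (induction i)
  case 0
  show ?case by (rule exI[of _ "\<lambda>e. e"]) simp
next
  case (Suc i)
  then obtain C where "\<forall>e acc ns fs v. length acc = j \<longrightarrow> length ns = k \<longrightarrow>
      kleene Fs Ts e (drop (k - i) ns @ acc @ ns) fs v \<longrightarrow> kleene Fs Ts (C e) (acc @ ns) fs v"
    by auto
  note C = this[rule_format]
  \<comment> \<open>Each copy shifts the list by one place to the right while the next argument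
    wanted lies one place further left, so its position is always \<open>j + k - 1\<close>.\<close>
  let ?p = "list_encode [6, 0, j + k - 1, list_encode [3]]"
  have "kleene Fs Ts (C (list_encode [4, e, ?p])) (acc @ ns) fs v"
    if len: "length acc = j" "length ns = k"
      and e: "kleene Fs Ts e (drop (k - Suc i) ns @ acc @ ns) fs v" for e acc ns fs v
  proof (rule C[OF len], rule kleene.S4)
    let ?st = "drop (k - i) ns @ acc @ ns"
    have nth: "?st ! (j + k - 1) = ns ! (k - Suc i)"
      using len Suc.prems by (cases "j = 0") (auto simp: nth_append)
    show "kleene Fs Ts ?p ?st fs (ns ! (k - Suc i))"
    proof (rule kleene.S6_0)
      show "j + k - 1 < length ?st" using len Suc.prems by simp
      show "kleene Fs Ts (list_encode [3]) (to_front (j + k - 1) ?st) fs (ns ! (k - Suc i))"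
        unfolding to_front_def nth by (rule kleene.S3)
    qed
    have "drop (k - Suc i) ns = ns ! (k - Suc i) # drop (k - i) ns"
      using len Suc.prems by (metis Cons_nth_drop_Suc Suc_diff_Suc Suc_le_lessD diff_less zero_less_Suc less_le_trans)
    with e show "kleene Fs Ts e (ns ! (k - Suc i) # ?st) fs v" by simp
  qed
  then show ?case by (intro exI[of _ "\<lambda>e. C (list_encode [4, e, ?p])"]) blast
qed

lemma kfun_under:
  assumes "kfun Ts k l F"
  obtains e where "\<And>acc ns fs. length acc = j \<Longrightarrow> length ns = k \<Longrightarrow> length fs = l \<Longrightarrow>
    kleene [exists2] Ts e (acc @ ns) fs (F ns fs)"
proof -
  from assms obtain e where e: "\<And>ns fs. length ns = k \<Longrightarrow> length fs = l \<Longrightarrow>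
      kleene [exists2] Ts e ns fs (F ns fs)"
    unfolding kfun_def by blast
  obtain C where "\<forall>e acc ns fs v. length acc = j \<longrightarrow> length ns = k \<longrightarrow>
      kleene [exists2] Ts e (ns @ acc @ ns) fs v \<longrightarrow> kleene [exists2] Ts (C e) (acc @ ns) fs v"
    using copy_args[of k k j "[exists2]" Ts] by auto
  note C = this[rule_format]
  have "length acc = j \<Longrightarrow> length ns = k \<Longrightarrow> length fs = l \<Longrightarrow>
      kleene [exists2] Ts (C e) (acc @ ns) fs (F ns fs)" for acc ns fs
    using C e kleene_append by blast
  then show ?thesis by (rule that)
qed

text \<open>Iterated S4, evaluating \<open>hs\<close> from the last to the first. Each function is
  evaluated underneath the values already pushed, by \<open>kfun_under\<close>.\<close>

lemma push_args:
  assumes "\<forall>h\<in>set hs. kfun Ts k l h"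
  shows "\<exists>C. \<forall>e ns fs v. length ns = k \<longrightarrow> length fs = l \<longrightarrow>
    kleene [exists2] Ts e (map (\<lambda>h. h ns fs) hs @ ns) fs v \<longrightarrow> kleene [exists2] Ts (C e) ns fs v"
  using assms
proof (induction hs)
  case Nil
  show ?case by (rule exI[of _ "\<lambda>e. e"]) simp
next
  case (Cons h hs)
  then obtain C where "\<forall>e ns fs v. length ns = k \<longrightarrow> length fs = l \<longrightarrow>
      kleene [exists2] Ts e (map (\<lambda>h. h ns fs) hs @ ns) fs v \<longrightarrow> kleene [exists2] Ts (C e) ns fs v"
    by auto
  note C = this[rule_format]
  have "kfun Ts k l h" using Cons.prems by simp
  from kfun_under[OF this, of "length hs"]
  obtain d where d: "\<And>acc ns fs. length acc = length hs \<Longrightarrow> length ns = k \<Longrightarrow> length fs = l \<Longrightarrow>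
      kleene [exists2] Ts d (acc @ ns) fs (h ns fs)"
    by blast
  have "kleene [exists2] Ts (C (list_encode [4, e, d])) ns fs v"
    if "length ns = k" "length fs = l"
      "kleene [exists2] Ts e (map (\<lambda>h. h ns fs) (h # hs) @ ns) fs v" for e ns fs v
    using that by (intro C kleene.S4[OF d]) auto
  then show ?case by (intro exI[of _ "\<lambda>e. C (list_encode [4, e, d])"]) blast
qed

lemma kfun_comp:
  assumes "kfun Ts (length hs) l F" and "\<forall>h\<in>set hs. kfun Ts k l h"
  shows "kfun Ts k l (\<lambda>ns fs. F (map (\<lambda>h. h ns fs) hs) fs)"
proof -
  from assms(1) obtain e where e: "\<And>ns fs. length ns = length hs \<Longrightarrow> length fs = l \<Longrightarrow>
      kleene [exists2] Ts e ns fs (F ns fs)"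
    unfolding kfun_def by blast
  obtain C where "\<And>e ns fs v. length ns = k \<Longrightarrow> length fs = l \<Longrightarrow>
      kleene [exists2] Ts e (map (\<lambda>h. h ns fs) hs @ ns) fs v \<Longrightarrow> kleene [exists2] Ts (C e) ns fs v"
    using push_args[OF assms(2)] by blast
  then have "\<forall>ns fs. length ns = k \<longrightarrow> length fs = l \<longrightarrow>
      kleene [exists2] Ts (C e) ns fs (F (map (\<lambda>h. h ns fs) hs) fs)"
    using kleene_append[OF e] by auto
  then show ?thesis unfolding kfun_def by blast
qed

section \<open>Closure rules that decompose a term along its syntax\<close>

named_theorems kc

lemma kfun_nth:
  assumes "i < k" shows "kfun Ts k l (\<lambda>ns fs. ns ! i)"
proof -
  have "kleene [exists2] Ts (list_encode [6, 0, i, list_encode [3]]) ns fs (ns ! i)"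
    if "length ns = k" for ns and fs
    using that assms by (intro kleene.S6_0) (auto simp: to_front_def intro: kleene.S3)
  then show ?thesis unfolding kfun_def by blast
qed

lemma kfun_proj:
  assumes "i < k" shows "kfun Ts k l (\<lambda>ns fs. hd ((tl ^^ i) ns))"
proof (rule kfun_cong[OF kfun_nth[OF assms]])
  fix ns :: "nat list" and fs :: "ty1 list"
  assume "length ns = k"
  have "(tl ^^ i) ns = drop i ns"
    by (induction i) (auto simp: drop_Suc tl_drop)
  then show "ns ! i = hd ((tl ^^ i) ns)" using assms \<open>length ns = k\<close> by (simp add: hd_drop_conv_nth)
qed

text \<open>Variables are in de Bruijn style: the rules for quantifiers and search turn the bound
  variable into \<open>hd ns\<close> and the old list into \<open>tl ns\<close>, so nested variables
  appear in exactly these forms.\<close>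

lemma kfun_var [kc]:
  "0 < k \<Longrightarrow> kfun Ts k l (\<lambda>ns fs. hd ns)"
  "1 < k \<Longrightarrow> kfun Ts k l (\<lambda>ns fs. hd (tl ns))"
  "2 < k \<Longrightarrow> kfun Ts k l (\<lambda>ns fs. hd (tl (tl ns)))"
  "3 < k \<Longrightarrow> kfun Ts k l (\<lambda>ns fs. hd (tl (tl (tl ns))))"
  "4 < k \<Longrightarrow> kfun Ts k l (\<lambda>ns fs. hd (tl (tl (tl (tl ns)))))"
  "5 < k \<Longrightarrow> kfun Ts k l (\<lambda>ns fs. hd (tl (tl (tl (tl (tl ns))))))"
  "6 < k \<Longrightarrow> kfun Ts k l (\<lambda>ns fs. hd (tl (tl (tl (tl (tl (tl ns)))))))"
  "7 < k \<Longrightarrow> kfun Ts k l (\<lambda>ns fs. hd (tl (tl (tl (tl (tl (tl (tl ns))))))))"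
  using kfun_proj[of 0 k] kfun_proj[of 1 k] kfun_proj[of 2 k] kfun_proj[of 3 k] kfun_proj[of 4 k]
    kfun_proj[of 5 k] kfun_proj[of 6 k] kfun_proj[of 7 k]
  by (simp_all add: numeral_eq_Suc)

lemma kfun_weaken:
  assumes "kfun Ts k l F" shows "kfun Ts (Suc k) l (\<lambda>ns fs. F (tl ns) fs)"
proof -
  obtain e where "\<And>acc ns fs. length acc = 1 \<Longrightarrow> length ns = k \<Longrightarrow> length fs = l \<Longrightarrow>
    kleene [exists2] Ts e (acc @ ns) fs (F ns fs)"
    using kfun_under[OF assms] by blast
  from this[of "[x]" for x]
  have "\<forall>ns fs. length ns = Suc k \<longrightarrow> length fs = l \<longrightarrow> kleene [exists2] Ts e ns fs (F (tl ns) fs)"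
    by (auto simp: length_Suc_conv)
  then show ?thesis unfolding kfun_def by blast
qed

lemma kfun_let:
  assumes "kfun Ts (Suc k) l (\<lambda>ns fs. F (hd ns) (tl ns) fs)" and "kfun Ts k l H"
  shows "kfun Ts k l (\<lambda>ns fs. F (H ns fs) ns fs)"
proof -
  from assms(1) obtain g where g: "\<And>ns fs. length ns = Suc k \<Longrightarrow> length fs = l \<Longrightarrow>
      kleene [exists2] Ts g ns fs (F (hd ns) (tl ns) fs)" unfolding kfun_def by blast
  from assms(2) obtain h where h: "\<And>ns fs. length ns = k \<Longrightarrow> length fs = l \<Longrightarrow>
      kleene [exists2] Ts h ns fs (H ns fs)" unfolding kfun_def by blast
  have "kleene [exists2] Ts (list_encode [4, g, h]) ns fs (F (H ns fs) ns fs)"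
    if "length ns = k" "length fs = l" for ns fs
    using that g[of "H ns fs # ns" fs for ns fs] by (intro kleene.S4[OF h]) auto
  then show ?thesis unfolding kfun_def by blast
qed

lemma kfun_comp1:
  assumes "kfun Ts 1 l (\<lambda>ns fs. F (hd ns) fs)" "kfun Ts k l A"
  shows "kfun Ts k l (\<lambda>ns fs. F (A ns fs) fs)"
  using kfun_comp[of Ts "[A]" l "\<lambda>ns fs. F (hd ns) fs" k] assms by simp

lemma kfun_comp2:
  assumes "kfun Ts 2 l (\<lambda>ns fs. F (hd ns) (hd (tl ns)) fs)" "kfun Ts k l A" "kfun Ts k l B"
  shows "kfun Ts k l (\<lambda>ns fs. F (A ns fs) (B ns fs) fs)"
  using kfun_comp[of Ts "[A, B]" l "\<lambda>ns fs. F (hd ns) (hd (tl ns)) fs" k] assms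
  by (simp add: numeral_eq_Suc)

lemma kfun_comp3:
  assumes "kfun Ts 3 l (\<lambda>ns fs. F (hd ns) (hd (tl ns)) (hd (tl (tl ns))) fs)"
    "kfun Ts k l A" "kfun Ts k l B" "kfun Ts k l C"
  shows "kfun Ts k l (\<lambda>ns fs. F (A ns fs) (B ns fs) (C ns fs) fs)"
  using kfun_comp[of Ts "[A, B, C]" l "\<lambda>ns fs. F (hd ns) (hd (tl ns)) (hd (tl (tl ns))) fs" k] assms
  by (simp add: numeral_eq_Suc)

lemma kfun_comp4:
  assumes "kfun Ts 4 l (\<lambda>ns fs. F (hd ns) (hd (tl ns)) (hd (tl (tl ns))) (hd (tl (tl (tl ns)))) fs)"
    "kfun Ts k l A" "kfun Ts k l B" "kfun Ts k l C" "kfun Ts k l D"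
  shows "kfun Ts k l (\<lambda>ns fs. F (A ns fs) (B ns fs) (C ns fs) (D ns fs) fs)"
  using kfun_comp[of Ts "[A, B, C, D]" l
      "\<lambda>ns fs. F (hd ns) (hd (tl ns)) (hd (tl (tl ns))) (hd (tl (tl (tl ns)))) fs" k] assms
  by (simp add: numeral_eq_Suc)

lemmas kpred_comp1 = kfun_comp1[where F = "\<lambda>x fs. if P x fs then 0 else 1" for P, folded kpred_def]
lemmas kpred_comp2 = kfun_comp2[where F = "\<lambda>x y fs. if P x y fs then 0 else 1" for P, folded kpred_def]
lemmas kpred_comp3 = kfun_comp3[where F = "\<lambda>x y z fs. if P x y z fs then 0 else 1" for P, folded kpred_def]
lemmas kpred_comp4 = kfun_comp4[where F = "\<lambda>x y z u fs. if P x y z u fs then 0 else 1" for P, folded kpred_def]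

lemma kfun_const [kc]: "kfun Ts k l (\<lambda>ns fs. c)"
  unfolding kfun_def by (blast intro: kleene.S2)

lemma kfun_Suc [kc]:
  assumes "kfun Ts k l A"
  shows "kfun Ts k l (\<lambda>ns fs. Suc (A ns fs))"
proof (rule kfun_comp1[OF _ assms])
  have "kleene [exists2] Ts (list_encode [1]) ns fs (Suc (hd ns))" if "length ns = 1" for ns fs
    using that kleene.S1[of "[exists2]" Ts "hd ns" "[]" fs] by (cases ns) auto
  then show "kfun Ts 1 l (\<lambda>ns fs. Suc (hd ns))" unfolding kfun_def by blast
qed

lemma kfun_apply [kc]:
  assumes "0 < l" "kfun Ts k l A"
  shows "kfun Ts k l (\<lambda>ns fs. hd fs (A ns fs))"
proof (rule kfun_comp1[OF _ assms(2)])
  have "kleene [exists2] Ts (list_encode [7]) ns fs (hd fs (hd ns))"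
    if "length ns = 1" "length fs = l" for ns fs
    using that assms(1) by (cases fs) (auto simp: length_Suc_conv intro: kleene.S7)
  then show "kfun Ts 1 l (\<lambda>ns fs. hd fs (hd ns))" unfolding kfun_def by blast
qed

lemma kfun_rec:
  assumes "kfun Ts k l A"
    and "kfun Ts (Suc (Suc k)) l (\<lambda>ns fs. H (hd ns) (hd (tl ns)) (tl (tl ns)) fs)"
    and "kfun Ts k l N"
  shows "kfun Ts k l (\<lambda>ns fs. rec_nat (A ns fs) (\<lambda>x y. H x y ns fs) (N ns fs))"
proof (rule kfun_let[OF _ assms(3)])
  from assms(1) obtain g where g: "\<And>ns fs. length ns = k \<Longrightarrow> length fs = l \<Longrightarrow>
      kleene [exists2] Ts g ns fs (A ns fs)" unfolding kfun_def by blast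
  from assms(2) obtain h where h: "\<And>ns fs. length ns = Suc (Suc k) \<Longrightarrow> length fs = l \<Longrightarrow>
      kleene [exists2] Ts h ns fs (H (hd ns) (hd (tl ns)) (tl (tl ns)) fs)" unfolding kfun_def by blast
  have "kleene [exists2] Ts (list_encode [5, g, h]) (n # ns) fs (rec_nat (A ns fs) (\<lambda>x y. H x y ns fs) n)"
    if len: "length ns = k" "length fs = l" for n ns fs
  proof (induction n)
    case 0
    show ?case using g len by (auto intro: kleene.S5_0)
  next
    case (Suc n)
    show ?case using h[of "n # y # ns" fs for y] len by (auto intro: kleene.S5_Suc[OF Suc])
  qed
  then have "\<forall>ns fs. length ns = Suc k \<longrightarrow> length fs = l \<longrightarrow> kleene [exists2] Ts (list_encode [5, g, h]) ns fs
      (rec_nat (A (tl ns) fs) (\<lambda>x y. H x y (tl ns) fs) (hd ns))"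
    by (auto simp: length_Suc_conv)
  then show "kfun Ts (Suc k) l (\<lambda>ns fs. rec_nat (A (tl ns) fs) (\<lambda>x y. H x y (tl ns) fs) (hd ns))"
    unfolding kfun_def by blast
qed

text \<open>Recursion on the flag of \<open>P\<close>: the base is \<open>A\<close>, and the step
  ignores predecessor and recursive value and returns \<open>B\<close>. S5 evaluates the base in
  either case, so \<open>A\<close> has to be total.\<close>

lemma kfun_if [kc]:
  assumes "kpred Ts k l P" "kfun Ts k l A" "kfun Ts k l B"
  shows "kfun Ts k l (\<lambda>ns fs. if P ns fs then A ns fs else B ns fs)"
  by (rule kfun_cong[OF kfun_rec[OF assms(2) assms(3)[THEN kfun_weaken, THEN kfun_weaken] assms(1)[unfolded kpred_def]]])
    auto

lemma kpred_not [kc]: "kpred Ts k l P \<Longrightarrow> kpred Ts k l (\<lambda>ns fs. \<not> P ns fs)"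
  by (subst kpred_def) (rule kfun_cong, erule kfun_if[OF _ kfun_const[of _ _ _ 1] kfun_const[of _ _ _ 0]], simp)

lemma kpred_conj [kc]:
  assumes "kpred Ts k l P" "kpred Ts k l Q"
  shows "kpred Ts k l (\<lambda>ns fs. P ns fs \<and> Q ns fs)"
  unfolding kpred_def
  by (rule kfun_cong[OF kfun_if[OF assms(1) assms(2)[unfolded kpred_def] kfun_const[of _ _ _ 1]]]) auto

lemma kpred_cong:
  assumes "kpred Ts k l P"
    and "\<And>ns fs. length ns = k \<Longrightarrow> length fs = l \<Longrightarrow> P ns fs \<longleftrightarrow> P' ns fs"
  shows "kpred Ts k l P'"
  using assms unfolding kpred_def by (auto elim!: kfun_cong)

lemma kpred_disj [kc]:
  assumes "kpred Ts k l P" "kpred Ts k l Q"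
  shows "kpred Ts k l (\<lambda>ns fs. P ns fs \<or> Q ns fs)"
proof -
  have "kpred Ts k l (\<lambda>ns fs. \<not> (\<not> P ns fs \<and> \<not> Q ns fs))" by (intro kc assms)
  then show ?thesis by simp
qed

lemma kpred_imp [kc]:
  assumes "kpred Ts k l P" "kpred Ts k l Q"
  shows "kpred Ts k l (\<lambda>ns fs. P ns fs \<longrightarrow> Q ns fs)"
proof -
  have "kpred Ts k l (\<lambda>ns fs. \<not> (P ns fs \<and> \<not> Q ns fs))" by (intro kc assms)
  then show ?thesis by simp
qed

lemma kpred_iff [kc]:
  assumes "kpred Ts k l P" "kpred Ts k l Q"
  shows "kpred Ts k l (\<lambda>ns fs. P ns fs \<longleftrightarrow> Q ns fs)"
  unfolding iff_conv_conj_imp by (intro kc assms)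

lemma kpred_ex [kc]:
  assumes "kpred Ts (Suc k) l (\<lambda>ns fs. P (hd ns) (tl ns) fs)"
  shows "kpred Ts k l (\<lambda>ns fs. \<exists>x. P x ns fs)"
proof -
  from assms obtain d where d: "\<And>ns fs. length ns = Suc k \<Longrightarrow> length fs = l \<Longrightarrow>
      kleene [exists2] Ts d ns fs (if P (hd ns) (tl ns) fs then 0 else 1)"
    unfolding kpred_def kfun_def by blast
  have "kleene [exists2] Ts (list_encode [8, 0, 0, d]) ns fs (if \<exists>x. P x ns fs then 0 else 1)"
    if "length ns = k" "length fs = l" for ns fs
  proof -
    have "kleene [exists2] Ts (list_encode [8, 0, 0, d]) ns fs
        (([exists2] ! 0) (\<lambda>x. if P x ns fs then 0 else 1))"
      using that d[of "x # ns" fs for x] by (intro kleene.S8_2) auto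
    moreover have "([exists2] ! 0) (\<lambda>x. if P x ns fs then 0 else 1) = (if \<exists>x. P x ns fs then 0 else 1)"
      by (simp add: exists2_def)
    ultimately show ?thesis by simp
  qed
  then show ?thesis unfolding kpred_def kfun_def by blast
qed

lemma kpred_all [kc]:
  assumes "kpred Ts (Suc k) l (\<lambda>ns fs. P (hd ns) (tl ns) fs)"
  shows "kpred Ts k l (\<lambda>ns fs. \<forall>x. P x ns fs)"
proof -
  have "kpred Ts k l (\<lambda>ns fs. \<not> (\<exists>x. \<not> P x ns fs))" by (intro kc assms)
  then show ?thesis by simp
qed

text \<open>Unbounded search, without the recursion theorem: the program \<open>d\<close> receives its own index as
  its second argument and passes it on through S9. The halting branch is the base case of S5,
  because S5 evaluates that branch in either case.\<close>

lemma kfun_Least [kc]: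
  assumes "kpred Ts (Suc k) l (\<lambda>ns fs. P (hd ns) (tl ns) fs)"
    and ex: "\<And>ns fs. length ns = k \<Longrightarrow> length fs = l \<Longrightarrow> \<exists>x. P x ns fs"
  shows "kfun Ts k l (\<lambda>ns fs. LEAST x. P x ns fs)"
proof -
  let ?K = "kleene [exists2] Ts"
  let ?flag = "\<lambda>x ns fs. if P x ns fs then 0 else 1 :: nat"
  have "kfun Ts (Suc k) l (\<lambda>ns fs. ?flag (hd ns) (tl ns) fs)"
    using assms(1) by (simp add: kpred_def)
  \<comment> \<open>The test is adapted to lists whose second entry is the program's own index,
    which it skips.\<close>
  then have "kfun Ts (length ((\<lambda>ns fs. ns ! 0) # map (\<lambda>i ns fs. ns ! (i + 2)) [0..<k])) l
      (\<lambda>ns fs. ?flag (hd ns) (tl ns) fs)" by simp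
  then have "kfun Ts (Suc (Suc k)) l (\<lambda>ns fs. (\<lambda>ns fs. ?flag (hd ns) (tl ns) fs)
       (map (\<lambda>h. h ns fs) ((\<lambda>ns fs. ns ! 0) # map (\<lambda>i ns fs. ns ! (i + 2)) [0..<k])) fs)"
    by (rule kfun_comp) (auto intro!: kfun_nth)
  then have "kfun Ts (Suc (Suc k)) l (\<lambda>ns fs. ?flag (hd ns) (tl (tl ns)) fs)"
    by (rule kfun_cong) (auto simp: length_Suc_conv comp_def map_nth)
  then obtain q where q: "\<And>ns fs. length ns = Suc (Suc k) \<Longrightarrow> length fs = l \<Longrightarrow>
      ?K q ns fs (?flag (hd ns) (tl (tl ns)) fs)" unfolding kfun_def by blast
  \<comment> \<open>The step case of S5 sees predecessor and recursive value in front of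
    \<open>n # x # ns\<close>. From these, \<open>hs\<close> prepares the call of \<open>x\<close>
    by S9: first the index \<open>x\<close> itself, then its arguments
    \<open>Suc n # x # ns\<close>.\<close>
  define hs :: "(nat list \<Rightarrow> ty1 list \<Rightarrow> nat) list" where
    "hs = (\<lambda>ns fs. ns ! 3) # (\<lambda>ns fs. Suc (ns ! 2)) # (\<lambda>ns fs. ns ! 3) # map (\<lambda>i ns fs. ns ! (i + 4)) [0..<k]"
  have "\<forall>h\<in>set hs. kfun Ts (k + 4) l h"
    unfolding hs_def by (auto intro!: kfun_nth kfun_Suc)
  from push_args[OF this] obtain C where C: "\<And>e ns fs v. length ns = k + 4 \<Longrightarrow> length fs = l \<Longrightarrow>
      ?K e (map (\<lambda>h. h ns fs) hs @ ns) fs v \<Longrightarrow> ?K (C e) ns fs v" by blast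
  define call where "call = C (list_encode [9, Suc (Suc k), l])"
  define d where "d = list_encode [4, list_encode [5, list_encode [3], call], q]"
  have call: "?K call (a # b # n # x # ns) fs v"
    if "length ns = k" "length fs = l" "?K x (Suc n # x # ns) fs v" for a b n x ns fs v
  proof -
    have "map (\<lambda>h. h (a # b # n # x # ns) fs) hs = x # Suc n # x # ns"
      using that(1) unfolding hs_def by (auto simp: comp_def map_nth numeral_eq_Suc)
    moreover have "?K (list_encode [9, Suc (Suc k), l]) (x # (Suc n # x # ns) @ a # b # n # x # ns) fs v"
      using that by (intro kleene.S9) auto
    ultimately show ?thesis unfolding call_def using that by (intro C) auto
  qed
  have halt: "?K d (n # x # ns) fs n" if "length ns = k" "length fs = l" "P n ns fs" for n x ns fs
  proof -
    have "?K q (n # x # ns) fs 0" using q[of "n # x # ns" fs] that by simp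
    then show ?thesis unfolding d_def by (rule kleene.S4) (intro kleene.S5_0 kleene.S3)
  qed
  have continue: "?K d (n # d # ns) fs v"
    if "length ns = k" "length fs = l" "\<not> P n ns fs" "?K d (Suc n # d # ns) fs v" for n ns fs v
  proof -
    have "?K q (n # d # ns) fs (Suc 0)" using q[of "n # d # ns" fs] that by simp
    then have "?K (list_encode [4, list_encode [5, list_encode [3], call], q]) (n # d # ns) fs v"
      by (rule kleene.S4)
        (rule kleene.S5_Suc, rule kleene.S5_0, rule kleene.S3, rule call, rule that, rule that, rule that)
    then show ?thesis by (simp only: d_def[symmetric])
  qed
  have search: "?K d (n # d # ns) fs (LEAST x. P x ns fs)"
    if len: "length ns = k" "length fs = l" and n: "n \<le> (LEAST x. P x ns fs)" for n ns fs
    using n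
  \<comment> \<open>Downward from the least solution: there the program halts, and each earlier call
    has the value of its successor.\<close>
  proof (induction rule: inc_induct)
    case base
    show ?case by (rule halt[OF len], rule LeastI_ex, rule ex[OF len])
  next
    case (step n)
    have "\<not> P n ns fs" using step.hyps(2) by (rule not_less_Least)
    then show ?case by (rule continue[OF len _ step.IH])
  qed
  \<comment> \<open>The search starts as \<open>d\<close> on \<open>0 # d # ns\<close>, with its own
    index pushed as a constant.\<close>
  let ?e = "list_encode [4, list_encode [4, d, list_encode [2, 0]], list_encode [2, d]]"
  have "?K ?e ns fs (LEAST x. P x ns fs)" if "length ns = k" "length fs = l" for ns fs
    by (rule kleene.S4[OF kleene.S2], rule kleene.S4[OF kleene.S2], rule search) (use that in auto)
  then show ?thesis unfolding kfun_def by blast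
qed

section \<open>Arithmetic\<close>

lemma kfun_pred [kc]: "kfun Ts k l A \<Longrightarrow> kfun Ts k l (\<lambda>ns fs. A ns fs - 1)"
proof -
  assume "kfun Ts k l A"
  then have "kfun Ts k l (\<lambda>ns fs. rec_nat 0 (\<lambda>x y. x) (A ns fs))"
    by (intro kfun_rec kc) simp
  moreover have "rec_nat 0 (\<lambda>x y. x) n = n - 1" for n :: nat by (cases n) auto
  ultimately show ?thesis by simp
qed

lemma kfun_plus [kc]:
  assumes "kfun Ts k l A" "kfun Ts k l B"
  shows "kfun Ts k l (\<lambda>ns fs. A ns fs + B ns fs)"
proof -
  have "kfun Ts k l (\<lambda>ns fs. rec_nat (A ns fs) (\<lambda>x y. Suc y) (B ns fs))"
    by (intro kfun_rec assms kc) simp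
  moreover have "rec_nat m (\<lambda>x y. Suc y) n = m + n" for m n :: nat by (induction n) auto
  ultimately show ?thesis by simp
qed

lemma kfun_minus [kc]:
  assumes "kfun Ts k l A" "kfun Ts k l B"
  shows "kfun Ts k l (\<lambda>ns fs. A ns fs - B ns fs)"
proof -
  have "kfun Ts k l (\<lambda>ns fs. rec_nat (A ns fs) (\<lambda>x y. y - 1) (B ns fs))"
    by (intro kfun_rec assms kfun_pred kc) simp
  moreover have "rec_nat m (\<lambda>x y. y - 1) n = m - n" for m n :: nat by (induction n) auto
  ultimately show ?thesis by simp
qed

lemma kpred_zero:
  assumes "kfun Ts k l A"
  shows "kpred Ts k l (\<lambda>ns fs. A ns fs = 0)"
proof -
  have "kfun Ts k l (\<lambda>ns fs. rec_nat 0 (\<lambda>x y. 1) (A ns fs))"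
    by (intro kfun_rec assms kc)
  moreover have "rec_nat 0 (\<lambda>x y. 1) n = (if n = 0 then 0 else 1 :: nat)" for n :: nat by (cases n) auto
  ultimately show ?thesis by (simp add: kpred_def)
qed

lemma kpred_less [kc]:
  assumes "kfun Ts k l A" "kfun Ts k l B"
  shows "kpred Ts k l (\<lambda>ns fs. A ns fs < B ns fs)"
proof -
  have "kpred Ts k l (\<lambda>ns fs. \<not> (B ns fs - A ns fs = 0))" by (intro kpred_zero kc assms)
  then show ?thesis by (simp add: not_le)
qed

lemma kpred_le [kc]:
  assumes "kfun Ts k l A" "kfun Ts k l B"
  shows "kpred Ts k l (\<lambda>ns fs. A ns fs \<le> B ns fs)"
proof -
  have "kpred Ts k l (\<lambda>ns fs. A ns fs - B ns fs = 0)" by (intro kpred_zero kc assms)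
  then show ?thesis by simp
qed

lemma kpred_eq [kc]:
  assumes "kfun Ts k l A" "kfun Ts k l B"
  shows "kpred Ts k l (\<lambda>ns fs. A ns fs = B ns fs)"
  unfolding eq_iff by (intro kc assms)

section \<open>Pairs and coded finite sequences\<close>

lemma kfun_prod_encode [kc]:
  assumes "kfun Ts k l A" "kfun Ts k l B"
  shows "kfun Ts k l (\<lambda>ns fs. prod_encode (A ns fs, B ns fs))"
proof -
  have "triangle n = rec_nat 0 (\<lambda>x y. y + Suc x) n" for n by (induction n) auto
  moreover have "kfun Ts k l (\<lambda>ns fs. rec_nat 0 (\<lambda>x y. y + Suc x) (A ns fs + B ns fs) + A ns fs)"
    by (intro kfun_rec kfun_plus kfun_Suc assms kc) simp_all
  ultimately show ?thesis by (simp add: prod_encode_def)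
qed

lemma kfun_Nil [kc]: "kfun Ts k l (\<lambda>ns fs. list_encode [])"
  by (rule kfun_const)

lemma kfun_Cons [kc]:
  assumes "kfun Ts k l A" "kfun Ts k l (\<lambda>ns fs. list_encode (X ns fs))"
  shows "kfun Ts k l (\<lambda>ns fs. list_encode (A ns fs # X ns fs))"
  unfolding list_encode.simps by (intro kc assms)

lemma kfun_list_decode [kc]:
  "kfun Ts k l A \<Longrightarrow> kfun Ts k l (\<lambda>ns fs. list_encode (list_decode (A ns fs)))"
  by simp

lemma kpred_ex_list [kc]:
  assumes "kpred Ts (Suc k) l (\<lambda>ns fs. P (list_decode (hd ns)) (tl ns) fs)"
  shows "kpred Ts k l (\<lambda>ns fs. \<exists>xs :: nat list. P xs ns fs)"
proof -
  have "kpred Ts k l (\<lambda>ns fs. \<exists>x. P (list_decode x) ns fs)" by (intro kc assms)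
  then show ?thesis by (rule kpred_cong) (metis list_encode_inverse)
qed

lemma kpred_eq_list [kc]:
  assumes "kfun Ts k l (\<lambda>ns fs. list_encode (X ns fs))" "kfun Ts k l (\<lambda>ns fs. list_encode (Y ns fs))"
  shows "kpred Ts k l (\<lambda>ns fs. X ns fs = Y ns fs)"
  using kpred_eq[OF assms] by (simp add: list_encode_eq)

text \<open>A list-valued function with a decidable graph is found by searching for the code of its
  value; the search ends because every list has a code.\<close>

lemma kfun_Least_list:
  assumes "kpred Ts (Suc k) l (\<lambda>ns fs. list_decode (hd ns) = X (tl ns) fs)"
  shows "kfun Ts k l (\<lambda>ns fs. list_encode (X ns fs))"
proof -
  have "kfun Ts k l (\<lambda>ns fs. LEAST x. list_decode x = X ns fs)"
    by (intro kc assms) (metis list_encode_inverse)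
  then show ?thesis
    by (rule kfun_cong) (rule Least_equality, auto, metis list_decode_inverse order_refl)
qed

lemma kfun_list_comp1:
  assumes "kfun Ts 1 l (\<lambda>ns fs. F (list_decode (hd ns)))"
    "kfun Ts k l (\<lambda>ns fs. list_encode (X ns fs))"
  shows "kfun Ts k l (\<lambda>ns fs. F (X ns fs))"
  using kfun_comp1[of Ts l "\<lambda>x fs. F (list_decode x)", OF assms] by simp

lemma kfun_tl [kc]:
  assumes "kfun Ts k l (\<lambda>ns fs. list_encode (X ns fs))"
  shows "kfun Ts k l (\<lambda>ns fs. list_encode (tl (X ns fs)))"
proof (rule kfun_list_comp1[OF kfun_Least_list assms])
  have "ys = tl xs \<longleftrightarrow> (xs = [] \<and> ys = []) \<or> (\<exists>x. xs = x # ys)" for xs ys :: "nat list"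
    by (cases xs) auto
  then show "kpred Ts (Suc 1) l (\<lambda>ns fs. list_decode (hd ns) = tl (list_decode (hd (tl ns))))"
    by (simp only:) (intro kc; simp)
qed

lemma kfun_drop [kc]:
  assumes "kfun Ts k l A" "kfun Ts k l (\<lambda>ns fs. list_encode (X ns fs))"
  shows "kfun Ts k l (\<lambda>ns fs. list_encode (drop (A ns fs) (X ns fs)))"
proof -
  have "list_encode (drop n xs) = rec_nat (list_encode xs) (\<lambda>x y. list_encode (tl (list_decode y))) n"
    for n and xs :: "nat list"
    by (induction n) (simp, metis drop_Suc list_encode_inverse old.nat.simps(7) tl_drop)
  moreover have "kfun Ts k l (\<lambda>ns fs. rec_nat (list_encode (X ns fs))
      (\<lambda>x y. list_encode (tl (list_decode y))) (A ns fs))"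
    by (intro kfun_rec assms kc) simp
  ultimately show ?thesis by simp
qed

text \<open>The default 0 makes access total, as \<open>kfun\<close> requires, with a value that is
  known out of range.\<close>

definition nth0 :: "nat list \<Rightarrow> nat \<Rightarrow> nat" where
  "nth0 xs i = (if i < length xs then xs ! i else 0)"

lemma kfun_nth0 [kc]:
  assumes "kfun Ts k l (\<lambda>ns fs. list_encode (X ns fs))" "kfun Ts k l A"
  shows "kfun Ts k l (\<lambda>ns fs. nth0 (X ns fs) (A ns fs))"
proof -
  have *: "nth0 xs i = x \<longleftrightarrow> (drop i xs = [] \<and> x = 0) \<or> drop i xs = x # drop (Suc i) xs" for xs i x
    unfolding nth0_def by (auto simp flip: Cons_nth_drop_Suc)
  have "nth0 xs i = (LEAST x. (drop i xs = [] \<and> x = 0) \<or> drop i xs = x # drop (Suc i) xs)" for xs i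
    unfolding *[symmetric] by (rule Least_equality[symmetric]) auto
  moreover have "kfun Ts 2 l (\<lambda>ns fs. LEAST x. (drop (hd (tl ns)) (list_decode (hd ns)) = [] \<and> x = 0)
      \<or> drop (hd (tl ns)) (list_decode (hd ns)) = x # drop (Suc (hd (tl ns))) (list_decode (hd ns)))"
    by (intro kc; simp only: *[symmetric]) simp_all
  ultimately have "kfun Ts 2 l (\<lambda>ns fs. nth0 (list_decode (hd ns)) (hd (tl ns)))" by simp
  from kfun_comp2[OF this assms] show ?thesis by simp
qed

lemma kfun_length [kc]:
  assumes "kfun Ts k l (\<lambda>ns fs. list_encode (X ns fs))"
  shows "kfun Ts k l (\<lambda>ns fs. length (X ns fs))"
proof (rule kfun_list_comp1[OF _ assms])
  have "length xs = (LEAST n. drop n xs = [])" for xs :: "nat list"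
    by (rule Least_equality[symmetric]) auto
  moreover have "kfun Ts 1 l (\<lambda>ns fs. LEAST n. drop n (list_decode (hd ns)) = [])"
    by (intro kc) (simp_all, metis order_refl)
  ultimately show "kfun Ts 1 l (\<lambda>ns fs. length (list_decode (hd ns)))" by simp
qed

text \<open>Codes are easily extended at the front only, so recursion on \<open>n\<close> naturally
  yields a reversal. Two of them give prefixes and concatenation.\<close>

fun rev_onto :: "nat list \<Rightarrow> nat list \<Rightarrow> nat \<Rightarrow> nat list" where
  "rev_onto xs ys 0 = ys"
| "rev_onto xs ys (Suc n) = (if n < length xs then nth0 xs n # rev_onto xs ys n else rev_onto xs ys n)"

lemma rev_onto_eq: "rev_onto xs ys n = rev (take n xs) @ ys"
  by (induction n) (auto simp: nth0_def take_Suc_conv_app_nth)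

lemma kfun_rev_onto:
  assumes "kfun Ts k l (\<lambda>ns fs. list_encode (X ns fs))" "kfun Ts k l (\<lambda>ns fs. list_encode (Y ns fs))"
    "kfun Ts k l A"
  shows "kfun Ts k l (\<lambda>ns fs. list_encode (rev_onto (X ns fs) (Y ns fs) (A ns fs)))"
proof -
  have "list_encode (rev_onto xs ys n) = rec_nat (list_encode ys)
     (\<lambda>x y. if x < length xs then list_encode (nth0 xs x # list_decode y) else y) n" for xs ys n
    by (induction n) (auto simp: list_encode.simps)
  moreover have "kfun Ts 3 l (\<lambda>ns fs. rec_nat (list_encode (list_decode (hd (tl ns))))
     (\<lambda>x y. if x < length (list_decode (hd ns)) then list_encode (nth0 (list_decode (hd ns)) x # list_decode y) else y)
        (hd (tl (tl ns))))"
    by (intro kfun_rec kc) simp_all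
  ultimately have "kfun Ts 3 l (\<lambda>ns fs. list_encode
      (rev_onto (list_decode (hd ns)) (list_decode (hd (tl ns))) (hd (tl (tl ns)))))" by simp
  from kfun_comp3[OF this assms] show ?thesis by simp
qed

lemma kfun_take_append:
  assumes "kfun Ts k l A" "kfun Ts k l (\<lambda>ns fs. list_encode (X ns fs))"
    "kfun Ts k l (\<lambda>ns fs. list_encode (Y ns fs))"
  shows "kfun Ts k l (\<lambda>ns fs. list_encode (take (A ns fs) (X ns fs) @ Y ns fs))"
proof -
  have "take n xs @ ys = rev_onto (rev_onto xs [] n) ys n" for n and xs ys :: "nat list"
    by (simp add: rev_onto_eq)
  then show ?thesis using assms by (simp only:) (intro kfun_rev_onto kfun_Nil)
qed

lemma kfun_take [kc]:
  assumes "kfun Ts k l A" "kfun Ts k l (\<lambda>ns fs. list_encode (X ns fs))"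
  shows "kfun Ts k l (\<lambda>ns fs. list_encode (take (A ns fs) (X ns fs)))"
  using kfun_take_append[OF assms kfun_Nil] by simp

text \<open>A path is coded by the list of its nodes, which turns the closure into number
  quantifiers that \<open>exists2\<close> can decide.\<close>

lemma rtranclp_iff_list:
  "R\<^sup>*\<^sup>* a b \<longleftrightarrow> (\<exists>xs n. nth0 xs 0 = a \<and> nth0 xs n = b \<and> (\<forall>i. i < n \<longrightarrow> R (nth0 xs i) (nth0 xs (Suc i))))"
  (is "_ \<longleftrightarrow> ?rhs")
proof
  assume "R\<^sup>*\<^sup>* a b"
  then obtain n f where f: "f 0 = a" "f n = b" "\<forall>i<n. R (f i) (f (Suc i))"
    unfolding rtranclp_power relpowp_fun_conv by blast
  have "nth0 (map f [0..<Suc n]) i = f i" if "i \<le> n" for i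
    using that by (simp add: nth0_def nth_append del: upt_Suc)
  with f show ?rhs by (intro exI[of _ "map f [0..<Suc n]"] exI[of _ n]) auto
next
  assume ?rhs
  then show "R\<^sup>*\<^sup>* a b" unfolding rtranclp_power relpowp_fun_conv by blast
qed

lemma kpred_rtranclp:
  assumes R: "\<And>k A B. kfun Ts k l A \<Longrightarrow> kfun Ts k l B \<Longrightarrow> kpred Ts k l (\<lambda>ns fs. R fs (A ns fs) (B ns fs))"
    and "kfun Ts k l A" "kfun Ts k l B"
  shows "kpred Ts k l (\<lambda>ns fs. (R fs)\<^sup>*\<^sup>* (A ns fs) (B ns fs))"
proof (rule kpred_comp2[OF _ assms(2,3)])
  show "kpred Ts 2 l (\<lambda>ns fs. (R fs)\<^sup>*\<^sup>* (hd ns) (hd (tl ns)))"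
    unfolding rtranclp_iff_list by (intro kc R; simp)
qed

section \<open>Application of \<open>\<Theta>\<close> to a computable functional\<close>

lemma kfun_Theta_length [kc]:
  assumes "kfun [\<Theta>] k (Suc l) (\<lambda>ns fs. G ns fs)"
  shows "kfun [\<Theta>] k l (\<lambda>ns fs. length (\<Theta> (\<lambda>f. G ns (f # fs))))"
proof -
  from assms obtain d where d: "\<And>ns fs. length ns = k \<Longrightarrow> length fs = Suc l \<Longrightarrow>
      kleene [exists2] [\<Theta>] d ns fs (G ns fs)" unfolding kfun_def by blast
  have "kleene [exists2] [\<Theta>] (list_encode [8, 1, 0, d]) ns fs (length (([\<Theta>] ! 0) (\<lambda>f. G ns (f # fs))))"
    if "length ns = k" "length fs = l" for ns fs
    using that by (intro kleene.S8_len allI d) auto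
  then show ?thesis unfolding kfun_def by auto
qed

text \<open>S8 for entries expects position and argument in front and hides them from
  \<open>d\<close>; \<open>push_args\<close> puts them there. The bound on \<open>I\<close> is
  needed because this instance of S8 is undefined out of range.\<close>

lemma kfun_Theta_entry:
  assumes "kfun [\<Theta>] k (Suc l) G" and I: "kfun [\<Theta>] k l I" and A: "kfun [\<Theta>] k l A"
    and less: "\<And>ns fs. length ns = k \<Longrightarrow> length fs = l \<Longrightarrow> I ns fs < length (\<Theta> (\<lambda>f. G ns (f # fs)))"
  shows "kfun [\<Theta>] k l (\<lambda>ns fs. (\<Theta> (\<lambda>f. G ns (f # fs)) ! I ns fs) (A ns fs))"
proof -
  from assms obtain d where d: "\<And>ns fs. length ns = k \<Longrightarrow> length fs = Suc l \<Longrightarrow>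
      kleene [exists2] [\<Theta>] d ns fs (G ns fs)" unfolding kfun_def by blast
  have "\<forall>h\<in>set [I, A]. kfun [\<Theta>] k l h" using I A by simp
  from push_args[OF this] obtain C where "\<forall>e ns fs v. length ns = k \<longrightarrow> length fs = l \<longrightarrow>
      kleene [exists2] [\<Theta>] e (map (\<lambda>h. h ns fs) [I, A] @ ns) fs v \<longrightarrow> kleene [exists2] [\<Theta>] (C e) ns fs v"
    by blast
  note C = this[rule_format]
  have "kleene [exists2] [\<Theta>] (C (list_encode [8, 2, 0, d])) ns fs ((\<Theta> (\<lambda>f. G ns (f # fs)) ! I ns fs) (A ns fs))"
    if "length ns = k" "length fs = l" for ns fs
  proof (rule C[OF that])
    have "kleene [exists2] [\<Theta>] (list_encode [8, 2, 0, d]) (I ns fs # A ns fs # ns) fs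
        ((([\<Theta>] ! 0) (\<lambda>f. G ns (f # fs)) ! I ns fs) (A ns fs))"
      using that by (intro kleene.S8_val allI d) (auto simp: less)
    then show "kleene [exists2] [\<Theta>] (list_encode [8, 2, 0, d]) (map (\<lambda>h. h ns fs) [I, A] @ ns) fs
        ((\<Theta> (\<lambda>f. G ns (f # fs)) ! I ns fs) (A ns fs))" by simp
  qed
  then show ?thesis unfolding kfun_def by blast
qed

section \<open>Computations in \<open>\<exists>\<^sup>2\<close> and their local errors\<close>

abbreviation conf :: "nat \<Rightarrow> nat list \<Rightarrow> nat" where
  "conf e ns \<equiv> prod_encode (e, list_encode ns)"

text \<open>
  The schemes that matter when \<open>\<exists>\<^sup>2\<close> is the only argument of higher type, in three shapes: \<open>bind\<close>
  first evaluates \<open>a\<close> and then, with its value \<open>y\<close>, evaluates \<open>b\<close>. A scheme with a single premise is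
  a \<open>bind\<close> whose second computation is the identity.
\<close>

definition leaf :: "nat \<Rightarrow> nat \<Rightarrow> bool" where
  "leaf t v \<longleftrightarrow>
     (\<exists>x ns. t = conf (list_encode [1]) (x # ns) \<and> v = Suc x) \<or>
     (\<exists>ns. t = conf (list_encode [2, v]) ns) \<or>
     (\<exists>ns. t = conf (list_encode [3]) (v # ns))"

definition bind :: "nat \<Rightarrow> nat \<Rightarrow> nat \<Rightarrow> nat \<Rightarrow> bool" where
  "bind t a y b \<longleftrightarrow>
     (\<exists>g h ns. t = conf (list_encode [4, g, h]) ns \<and> a = conf h ns \<and> b = conf g (y # ns)) \<or>
     (\<exists>g h x ns. t = conf (list_encode [5, g, h]) (Suc x # ns) \<and>
        a = conf (list_encode [5, g, h]) (x # ns) \<and> b = conf h (x # y # ns)) \<or>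
     b = conf (list_encode [3]) [y] \<and>
     ((\<exists>g h ns. t = conf (list_encode [5, g, h]) (0 # ns) \<and> a = conf g ns) \<or>
      (\<exists>k g ns. t = conf (list_encode [6, 0, k, g]) ns \<and> k < length ns \<and> a = conf g (to_front k ns)) \<or>
      (\<exists>m x ns. t = conf (list_encode [9, m, 0]) (x # ns) \<and> m \<le> length ns \<and> a = conf x (take m ns)))"

definition branch :: "nat \<Rightarrow> nat \<Rightarrow> nat \<Rightarrow> bool" where
  "branch t x c \<longleftrightarrow> (\<exists>d ns. t = conf (list_encode [8, 0, 0, d]) ns \<and> c = conf d (x # ns))"

inductive conv :: "nat \<Rightarrow> nat \<Rightarrow> bool" where
  leaf: "leaf t v \<Longrightarrow> conv t v"
| bind: "bind t a y b \<Longrightarrow> conv a y \<Longrightarrow> conv b v \<Longrightarrow> conv t v"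
| branch: "(\<forall>x. branch t x (c x)) \<Longrightarrow> (\<forall>x. conv (c x) (\<phi> x)) \<Longrightarrow> conv t (exists2 \<phi>)"

text \<open>Here and below: the leading number of an index reveals the scheme. So the three shapes
  exclude each other and \<open>t\<close> determines its subcomputations, the second one of a
  \<open>bind\<close> only together with \<open>y\<close>.\<close>

lemma leaf_unique: "leaf t v \<Longrightarrow> leaf t w \<Longrightarrow> w = v"
  unfolding leaf_def by (auto simp: list_encode_eq)

lemma bind_unique: "bind t a y b \<Longrightarrow> bind t a' y' b' \<Longrightarrow> a' = a \<and> (y' = y \<longrightarrow> b' = b)"
  unfolding bind_def by (elim disjE conjE exE) (simp_all add: list_encode_eq)

lemma branch_unique: "branch t x c \<Longrightarrow> branch t x c' \<Longrightarrow> c' = c"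
  unfolding branch_def by (auto simp: list_encode_eq)

lemma leaf_not_bind: "leaf t v \<Longrightarrow> \<not> bind t a y b"
  unfolding leaf_def bind_def by (auto simp: list_encode_eq)

lemma leaf_not_branch: "leaf t v \<Longrightarrow> \<not> branch t x c"
  unfolding leaf_def branch_def by (auto simp: list_encode_eq)

lemma bind_not_branch: "bind t a y b \<Longrightarrow> \<not> branch t x c"
  unfolding bind_def branch_def by (auto simp: list_encode_eq)

lemma conv_return: "bind t a v (conf (list_encode [3]) [v]) \<Longrightarrow> conv a v \<Longrightarrow> conv t v"
proof -
  have "leaf (conf (list_encode [3]) [v]) v" by (auto simp: leaf_def)
  then show "bind t a v (conf (list_encode [3]) [v]) \<Longrightarrow> conv a v \<Longrightarrow> conv t v"
    by (blast intro: conv.leaf conv.bind)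
qed

text \<open>Without function arguments and without \<open>\<Theta>\<close>, the schemes S6_1, S7,
  S8_len and S8_val cannot apply, S8_2 has \<open>k = 0\<close> and S9 has \<open>l = 0\<close>.
  What remains is covered by the three shapes.\<close>

lemma kleene_conv:
  assumes "kleene [exists2] [] e ns fs v" and "fs = []"
  shows "conv (conf e ns) v"
  using assms
proof (induction rule: kleene.induct)
  case (S4 h ns fs y g z)
  then have "conv (conf h ns) y" "conv (conf g (y # ns)) z" by auto
  then show ?case by (rule conv.bind[rotated]) (auto simp: bind_def list_encode_eq)
next
  case (S5_0 g ns fs z h)
  then have "conv (conf g ns) z" by auto
  then show ?case by (rule conv_return[rotated]) (auto simp: bind_def)
next
  case (S5_Suc g h x ns fs y z)
  then have "conv (conf (list_encode [5, g, h]) (x # ns)) y" "conv (conf h (x # y # ns)) z" by auto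
  then show ?case by (rule conv.bind[rotated]) (auto simp: bind_def list_encode_eq)
next
  case (S6_0 k ns g fs z)
  then have "conv (conf g (to_front k ns)) z" by auto
  then show ?case by (rule conv_return[rotated]) (use S6_0.hyps in \<open>auto simp: bind_def\<close>)
next
  case (S8_2 k d ns fs \<phi>)
  then have "\<forall>x. conv (conf d (x # ns)) (\<phi> x)" by auto
  then have "conv (conf (list_encode [8, 0, 0, d]) ns) (exists2 \<phi>)"
    by (rule conv.branch[rotated]) (auto simp: branch_def)
  with S8_2 show ?case by simp
next
  case (S9 m ns l fs x z)
  then have "conv (conf x (take m ns)) z" by auto
  then show ?case by (rule conv_return[rotated]) (use S9 in \<open>auto simp: bind_def\<close>)
qed (auto intro!: conv.leaf simp: leaf_def)

text \<open>One unfolding of \<open>conv\<close> with the values of subcomputations looked up in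
  \<open>S\<close>. In the last case \<open>exists2\<close> is expressed by a quantifier over
  branches, which keeps \<open>step\<close> arithmetical in \<open>S\<close>.\<close>

definition step :: "(nat \<Rightarrow> nat \<Rightarrow> bool) \<Rightarrow> nat \<Rightarrow> nat \<Rightarrow> bool" where
  "step S t v \<longleftrightarrow> leaf t v \<or> (\<exists>a y b. bind t a y b \<and> S a y \<and> S b v) \<or>
     (\<exists>x c. branch t x c) \<and> v = (if \<exists>x c. branch t x c \<and> S c 0 then 0 else 1)"

definition child :: "(nat \<Rightarrow> nat \<Rightarrow> bool) \<Rightarrow> nat \<Rightarrow> nat \<Rightarrow> bool" where
  "child S t a \<longleftrightarrow> (\<exists>y b. bind t a y b) \<or> (\<exists>a' y. bind t a' y a \<and> S a' y) \<or> (\<exists>x. branch t x a)"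

text \<open>Stated by a closure rather than by recursion, so that it is arithmetical in
  \<open>S\<close>; \<open>good_iff\<close> recovers the recursive form.\<close>

definition good :: "(nat \<Rightarrow> nat \<Rightarrow> bool) \<Rightarrow> nat \<Rightarrow> bool" where
  "good S t \<longleftrightarrow> (\<forall>a. (child S)\<^sup>*\<^sup>* t a \<longrightarrow> (\<forall>v. S a v \<longleftrightarrow> step S a v))"

definition visit :: "(nat \<Rightarrow> nat \<Rightarrow> bool) \<Rightarrow> nat \<Rightarrow> nat \<Rightarrow> bool" where
  "visit S t a \<longleftrightarrow>
     (\<exists>y b. bind t a y b) \<or> (\<exists>a' y. bind t a' y a \<and> good S a' \<and> S a' y) \<or> (\<exists>x. branch t x a)"

text \<open>The minimality is relative to the claims of \<open>S\<close>: even when \<open>r\<close> converges, an arbitrary descendant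
  of \<open>r\<close> under \<open>child S\<close> may fail to converge, and there an error need not be a deviation from \<open>conv\<close>.
  Hence the restriction to visited computations.\<close>

definition min_error :: "(nat \<Rightarrow> nat \<Rightarrow> bool) \<Rightarrow> nat \<Rightarrow> nat \<Rightarrow> nat \<Rightarrow> bool" where
  "min_error S r t v \<longleftrightarrow>
     (visit S)\<^sup>*\<^sup>* r t \<and> (\<forall>a. child S t a \<longrightarrow> good S a) \<and> \<not> (S t v \<longleftrightarrow> step S t v)"

definition claims :: "ty1 \<Rightarrow> nat \<Rightarrow> nat \<Rightarrow> bool" where
  "claims f t v \<longleftrightarrow> f (prod_encode (t, v)) = 1"

text \<open>One more than the least code of an error, so that this code lies strictly below; 0 if
  there is no error, which makes the functional total.\<close>

definition bound :: "nat \<Rightarrow> ty2" where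
  "bound r f = (LEAST N. (\<exists>t v. min_error (claims f) r t v \<and> prod_encode (t, v) < N) \<or>
                         \<not> (\<exists>t v. min_error (claims f) r t v))"

section \<open>Claims compared with true values\<close>

lemma step_leaf: "leaf t v \<Longrightarrow> step S t w \<longleftrightarrow> w = v"
  unfolding step_def using leaf_unique leaf_not_bind leaf_not_branch by blast

lemma step_bind:
  assumes "bind t a y b" "\<And>y'. S a y' \<longleftrightarrow> y' = y" "\<And>w. S b w \<longleftrightarrow> w = v"
  shows "step S t w \<longleftrightarrow> w = v"
proof -
  have "(\<exists>a y b. bind t a y b \<and> S a y \<and> S b w) \<longleftrightarrow> w = v"
    using assms bind_unique by metis
  moreover have "\<not> leaf t w" "\<not> (\<exists>x c. branch t x c)"
    using assms(1) leaf_not_bind bind_not_branch by blast+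
  ultimately show ?thesis unfolding step_def by blast
qed

lemma step_branch:
  assumes "\<forall>x. branch t x (c x)" "\<And>x w. S (c x) w \<longleftrightarrow> w = \<phi> x"
  shows "step S t w \<longleftrightarrow> w = exists2 \<phi>"
proof -
  have "\<not> leaf t w" "\<not> (\<exists>a y b. bind t a y b)" "\<exists>x c. branch t x c"
    using assms(1) leaf_not_branch bind_not_branch by blast+
  moreover have "(\<exists>x c. branch t x c \<and> S c 0) \<longleftrightarrow> (\<exists>x. \<phi> x = 0)"
    using assms branch_unique by metis
  ultimately show ?thesis unfolding step_def exists2_def by auto
qed

lemma conv_unique: "conv t v \<Longrightarrow> conv t w \<longleftrightarrow> w = v"
proof (induction arbitrary: w rule: conv.induct)
  case (leaf t v)
  then show ?case
    by (metis conv.cases conv.leaf leaf_unique leaf_not_bind leaf_not_branch)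
next
  case (bind t a y b v)
  show ?case
  proof
    assume "conv t w"
    then show "w = v"
    proof cases
      case (bind a' y' b')
      then show ?thesis using bind_unique[OF \<open>bind t a y b\<close>] bind.IH by metis
    qed (use \<open>bind t a y b\<close> leaf_not_bind bind_not_branch in blast)+
  next
    assume "w = v"
    then show "conv t w" using bind conv.bind by blast
  qed
next
  case (branch t c \<phi>)
  then have c: "branch t x (c x)" "conv (c x) (\<phi> x)" "conv (c x) w \<longleftrightarrow> w = \<phi> x" for x w by auto
  show ?case
  proof
    assume "conv t w"
    then show "w = exists2 \<phi>"
    proof cases
      case (branch c' \<phi>')
      then have "c' x = c x" for x using branch_unique c(1) by blast
      with branch have "\<phi>' x = \<phi> x" for x using c(3) by metis
      then have "\<phi>' = \<phi>" by blast
      with branch show ?thesis by simp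
    qed (use c(1) leaf_not_branch bind_not_branch in blast)+
  next
    assume "w = exists2 \<phi>"
    then show "conv t w" using c conv.branch by blast
  qed
qed

lemma good_iff: "good S t \<longleftrightarrow> (\<forall>v. S t v \<longleftrightarrow> step S t v) \<and> (\<forall>a. child S t a \<longrightarrow> good S a)"
proof
  assume "good S t"
  then show "(\<forall>v. S t v \<longleftrightarrow> step S t v) \<and> (\<forall>a. child S t a \<longrightarrow> good S a)"
    unfolding good_def by (blast intro: converse_rtranclp_into_rtranclp)
next
  assume *: "(\<forall>v. S t v \<longleftrightarrow> step S t v) \<and> (\<forall>a. child S t a \<longrightarrow> good S a)"
  show "good S t"
    unfolding good_def
  proof (intro allI impI)
    fix a v assume "(child S)\<^sup>*\<^sup>* t a"
    then show "S a v \<longleftrightarrow> step S a v"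
      by (cases rule: converse_rtranclpE) (use * in \<open>auto simp: good_def\<close>)
  qed
qed

text \<open>Induction on convergence. In a \<open>bind\<close>, goodness passes to \<open>a\<close>;
  the induction hypothesis makes \<open>y\<close> its claimed value, whence \<open>b\<close> is a
  child as well and also good.\<close>

lemma good_value: "conv t v \<Longrightarrow> good S t \<Longrightarrow> S t w \<longleftrightarrow> w = v"
proof (induction arbitrary: w rule: conv.induct)
  case (leaf t v)
  then show ?case using step_leaf[of t v S w] good_iff[of S t] by blast
next
  case (bind t a y b v)
  have "good S a" using bind.prems bind.hyps(1) unfolding good_iff[of S t] child_def by blast
  then have a: "S a y' \<longleftrightarrow> y' = y" for y' by (rule bind.IH)
  then have "good S b" using bind.prems bind.hyps(1) unfolding good_iff[of S t] child_def by blast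
  then have "S b w \<longleftrightarrow> w = v" for w by (rule bind.IH)
  with a show ?case using step_bind[OF bind.hyps(1), of S] bind.prems good_iff[of S t] by blast
next
  case (branch t c \<phi>)
  have "good S (c x)" for x using branch unfolding good_iff[of S t] child_def by blast
  then have "S (c x) w \<longleftrightarrow> w = \<phi> x" for x w using branch.IH by blast
  with branch.hyps show ?case using step_branch[of t c S \<phi>] branch.prems good_iff[of S t] by blast
qed

text \<open>Nothing is assumed about the claims at \<open>t\<close> itself: correct children already
  force the locally computed value to be the true one. Hence a minimal error at a convergent
  \<open>t\<close> deviates from \<open>conv\<close>.\<close>

lemma step_good_children:
  assumes "conv t v" "\<And>a. child S t a \<Longrightarrow> good S a"
  shows "step S t w \<longleftrightarrow> w = v"
  using assms(1)
proof cases
  case leaf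
  then show ?thesis by (rule step_leaf)
next
  case (bind a y b)
  then have "good S a" using assms(2) child_def by blast
  with bind have a: "S a y' \<longleftrightarrow> y' = y" for y' using good_value by blast
  with bind have "good S b" using assms(2) child_def by blast
  with bind have "S b w \<longleftrightarrow> w = v" for w using good_value by blast
  with bind a show ?thesis using step_bind by blast
next
  case (branch c \<phi>)
  then have "good S (c x)" for x using assms(2) child_def by blast
  then have "S (c x) w \<longleftrightarrow> w = \<phi> x" for x w using branch good_value by blast
  with branch show ?thesis using step_branch[of t c S \<phi>] by blast
qed

lemma visit_conv:
  assumes "(visit S)\<^sup>*\<^sup>* r t" "conv r v"
  shows "\<exists>w. conv t w"
  using assms
proof (induction arbitrary: v rule: converse_rtranclp_induct)
  case base
  then show ?case by blast
next
  case (step r a)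
  have "\<exists>w. conv a w"
    using \<open>conv r v\<close>
  proof cases
    case leaf
    then show ?thesis using step.hyps leaf_not_bind leaf_not_branch unfolding visit_def by blast
  next
    case (bind a' y b)
    have "\<not> branch r x c" for x c using bind bind_not_branch by blast
    with step.hyps consider y' b' where "bind r a y' b'"
      | a'' y' where "bind r a'' y' a" "good S a''" "S a'' y'"
      unfolding visit_def by blast
    then show ?thesis
    proof cases
      case 1
      then show ?thesis using bind bind_unique by blast
    next
      case 2
      then have "a'' = a'" using bind bind_unique by blast
      \<comment> \<open>This is where \<open>visit\<close> needs the first subcomputation to be
        good: its claimed value is then true, and the computation entered is the actual second
        one.\<close>
      then have "y' = y" using 2 bind good_value by blast
      then have "a = b" using 2 bind bind_unique by blast
      with bind show ?thesis by blast
    qed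
  next
    case (branch c \<phi>)
    then obtain x where "branch r x a"
      using step.hyps bind_not_branch unfolding visit_def by blast
    then have "a = c x" using branch branch_unique by blast
    with branch show ?thesis by blast
  qed
  then show ?case using step.IH by blast
qed

lemma min_error_visit: "visit S r a \<Longrightarrow> min_error S a t w \<Longrightarrow> min_error S r t w"
  unfolding min_error_def by (meson converse_rtranclp_into_rtranclp)

text \<open>Descent along convergence: move to \<open>a\<close> if it is bad, to \<open>b\<close> if
  only that one is bad, or to a bad branch. If all of them are good, the error is at
  \<open>t\<close> itself.\<close>

lemma min_error_exists: "conv r v \<Longrightarrow> \<not> good S r \<Longrightarrow> \<exists>t w. min_error S r t w"
proof (induction rule: conv.induct)
  case (leaf t v)
  then have "\<not> child S t a" for a using leaf_not_bind leaf_not_branch unfolding child_def by blast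
  with leaf.prems show ?case unfolding good_iff[of S t] min_error_def by blast
next
  case (bind t a y b v)
  consider "\<not> good S a" | "good S a" "\<not> good S b" | "good S a" "good S b" by blast
  then show ?case
  proof cases
    case 1
    then show ?thesis using bind min_error_visit unfolding visit_def by blast
  next
    case 2
    then have "S a y" using bind good_value by blast
    with 2 bind have "visit S t b" unfolding visit_def by blast
    then show ?thesis using 2 bind min_error_visit by blast
  next
    case 3
    \<comment> \<open>A good \<open>a\<close> has the single claim \<open>y\<close>, so no wrong
      value can produce a further child.\<close>
    have "good S a'" if "child S t a'" for a'
      using that 3 bind.hyps bind_unique good_value bind_not_branch unfolding child_def by metis
    with bind.prems show ?thesis unfolding good_iff[of S t] min_error_def by blast
  qed
next
  case (branch t c \<phi>)
  show ?case
  proof (cases "\<forall>x. good S (c x)")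
    case True
    have "good S a" if "child S t a" for a
      using that True branch.hyps branch_unique bind_not_branch unfolding child_def by metis
    with branch.prems show ?thesis unfolding good_iff[of S t] min_error_def by blast
  next
    case False
    then obtain x where "\<not> good S (c x)" by blast
    moreover have "visit S t (c x)" using branch.hyps unfolding visit_def by blast
    ultimately show ?thesis using branch.IH min_error_visit by blast
  qed
qed

text \<open>The covering property is applied to the characteristic function of \<open>conv\<close>.
  The entry \<open>g\<close> obtained is true below its own bound, where its minimal error would
  have to lie.\<close>

lemma SFF_entry:
  assumes "SFF \<Theta>" "conv r v"
  obtains g where "g \<in> set (\<Theta> (bound r))" "\<And>w. claims g r w \<longleftrightarrow> w = v"
proof -
  define f :: ty1 where "f c = (case prod_decode c of (t, w) \<Rightarrow> if conv t w then 1 else 0)" for c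
  have "range f \<subseteq> {0, 1}" by (auto simp: f_def split: prod.split)
  with assms(1) obtain g where g: "g \<in> set (\<Theta> (bound r))" "f \<in> nbhd (init_seg g (bound r g))"
    unfolding SFF_def by blast
  from g(2) have agree: "f c = g c" if "c < bound r g" for c
    using that by (auto simp: nbhd_def init_seg_def)
  have "good (claims g) r"
  proof (rule ccontr)
    assume "\<not> good (claims g) r"
    then have "\<exists>t w. min_error (claims g) r t w" using assms(2) min_error_exists by blast
    then have "\<exists>t w. min_error (claims g) r t w \<and> prod_encode (t, w) < bound r g"
      unfolding bound_def
      by (smt (verit, del_insts) LeastI_ex lessI)
    then obtain t w where err: "min_error (claims g) r t w" and "prod_encode (t, w) < bound r g"
      by blast
    then have "claims g t w \<longleftrightarrow> conv t w"
      using agree unfolding claims_def by (auto simp: f_def simp flip: agree)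
    moreover obtain u where u: "conv t u"
      using err assms(2) visit_conv unfolding min_error_def by blast
    \<comment> \<open>The children of a minimal error are good, so \<open>step\<close> agrees with
      \<open>conv\<close>; so do the claims of \<open>g\<close>, and the error disappears.\<close>
    have "step (claims g) t w \<longleftrightarrow> conv t w"
      using step_good_children[OF u] conv_unique[OF u] err unfolding min_error_def by blast
    ultimately show False using err unfolding min_error_def by blast
  qed
  then show ?thesis using that g(1) good_value[OF assms(2)] by blast
qed

section \<open>The bounding functional is computable in \<open>\<exists>\<^sup>2\<close>\<close>

text \<open>As in the lemmas below, the definition is unfolded for variables only; the composition
  rule then substitutes arbitrary terms.\<close>

lemma kpred_leaf [kc]:
  assumes "kfun Ts k l A" "kfun Ts k l B"
  shows "kpred Ts k l (\<lambda>ns fs. leaf (A ns fs) (B ns fs))"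
proof (rule kpred_comp2[OF _ assms])
  show "kpred Ts 2 l (\<lambda>ns fs. leaf (hd ns) (hd (tl ns)))"
    unfolding leaf_def by (intro kc; simp)
qed

lemma kpred_branch [kc]:
  assumes "kfun Ts k l A" "kfun Ts k l B" "kfun Ts k l C"
  shows "kpred Ts k l (\<lambda>ns fs. branch (A ns fs) (B ns fs) (C ns fs))"
proof (rule kpred_comp3[OF _ assms])
  show "kpred Ts 3 l (\<lambda>ns fs. branch (hd ns) (hd (tl ns)) (hd (tl (tl ns))))"
    unfolding branch_def by (intro kc; simp)
qed

lemma kpred_bind [kc]:
  assumes "kfun Ts k l A" "kfun Ts k l B" "kfun Ts k l C" "kfun Ts k l D"
  shows "kpred Ts k l (\<lambda>ns fs. bind (A ns fs) (B ns fs) (C ns fs) (D ns fs))"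
proof (rule kpred_comp4[OF _ assms])
  \<comment> \<open>Under the guard, \<open>to_front\<close> is rewritten with the total
    \<open>nth0\<close>, for which a rule exists.\<close>
  have *: "k < length ns \<and> a = conf g (to_front k ns) \<longleftrightarrow>
      k < length ns \<and> a = conf g (nth0 ns k # take k ns @ drop (Suc k) ns)" for k a g ns
    by (auto simp: to_front_def nth0_def)
  show "kpred Ts 4 l (\<lambda>ns fs. bind (hd ns) (hd (tl ns)) (hd (tl (tl ns))) (hd (tl (tl (tl ns)))))"
    unfolding bind_def * by (intro kc kfun_take_append; simp)
qed

lemma kpred_claims [kc]:
  assumes "0 < l" "kfun Ts k l A" "kfun Ts k l B"
  shows "kpred Ts k l (\<lambda>ns fs. claims (hd fs) (A ns fs) (B ns fs))"
  unfolding claims_def by (intro kc assms)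

lemma kpred_step [kc]:
  assumes "0 < l" "kfun Ts k l A" "kfun Ts k l B"
  shows "kpred Ts k l (\<lambda>ns fs. step (claims (hd fs)) (A ns fs) (B ns fs))"
proof (rule kpred_comp2[OF _ assms(2,3)])
  show "kpred Ts 2 l (\<lambda>ns fs. step (claims (hd fs)) (hd ns) (hd (tl ns)))"
    unfolding step_def by (intro kc assms(1); simp)
qed

lemma kpred_child:
  assumes "0 < l" "kfun Ts k l A" "kfun Ts k l B"
  shows "kpred Ts k l (\<lambda>ns fs. child (claims (hd fs)) (A ns fs) (B ns fs))"
proof (rule kpred_comp2[OF _ assms(2,3)])
  show "kpred Ts 2 l (\<lambda>ns fs. child (claims (hd fs)) (hd ns) (hd (tl ns)))"
    unfolding child_def by (intro kc assms(1); simp)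
qed

lemma kpred_good:
  assumes "0 < l" "kfun Ts k l A"
  shows "kpred Ts k l (\<lambda>ns fs. good (claims (hd fs)) (A ns fs))"
proof (rule kpred_comp1[OF _ assms(2)])
  show "kpred Ts 1 l (\<lambda>ns fs. good (claims (hd fs)) (hd ns))"
    unfolding good_def by (intro kpred_rtranclp kpred_child kc assms(1); simp)
qed

lemma kpred_visit:
  assumes "0 < l" "kfun Ts k l A" "kfun Ts k l B"
  shows "kpred Ts k l (\<lambda>ns fs. visit (claims (hd fs)) (A ns fs) (B ns fs))"
proof (rule kpred_comp2[OF _ assms(2,3)])
  show "kpred Ts 2 l (\<lambda>ns fs. visit (claims (hd fs)) (hd ns) (hd (tl ns)))"
    unfolding visit_def by (intro kpred_good kc assms(1); simp)
qed

lemma kpred_min_error: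
  assumes "0 < l" "kfun Ts k l A" "kfun Ts k l B" "kfun Ts k l C"
  shows "kpred Ts k l (\<lambda>ns fs. min_error (claims (hd fs)) (A ns fs) (B ns fs) (C ns fs))"
proof (rule kpred_comp3[OF _ assms(2-4)])
  show "kpred Ts 3 l (\<lambda>ns fs. min_error (claims (hd fs)) (hd ns) (hd (tl ns)) (hd (tl (tl ns))))"
    unfolding min_error_def
    by (intro kpred_rtranclp kpred_child kpred_good kpred_visit kc assms(1); simp)
qed

lemma kfun_bound:
  assumes "0 < l" "kfun Ts k l A"
  shows "kfun Ts k l (\<lambda>ns fs. bound (A ns fs) (hd fs))"
proof (rule kfun_comp1[OF _ assms(2)])
  show "kfun Ts 1 l (\<lambda>ns fs. bound (hd ns) (hd fs))"
    unfolding bound_def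
  proof (intro kpred_min_error kc assms(1))
    fix ns :: "nat list" and fs :: "ty1 list"
    \<comment> \<open>The search ends for every function: beyond the code of an error, or at once if
      there is none.\<close>
    show "\<exists>N. (\<exists>t v. min_error (claims (hd fs)) (hd ns) t v \<and> prod_encode (t, v) < N) \<or>
      \<not> (\<exists>t v. min_error (claims (hd fs)) (hd ns) t v)"
      using lessI by blast
  qed simp_all
qed

section \<open>Diagonalization\<close>

theorem corollary5p2:
  fixes \<Theta> :: "((nat \<Rightarrow> nat) \<Rightarrow> nat) \<Rightarrow> (nat \<Rightarrow> nat) list"
  assumes "SFF \<Theta>"
  shows "\<exists>f :: nat \<Rightarrow> nat.
           computable_in [exists2] [\<Theta>] f \<and> \<not> computable_in [exists2] [] f"
proof -
  \<comment> \<open>Positions out of range default to entry 0, so that \<open>entry\<close> is total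
    and \<open>i\<close> can range over all numbers.\<close>
  define entry where "entry n i = \<Theta> (bound (conf n [n])) ! (if i < length (\<Theta> (bound (conf n [n]))) then i else 0)" for n i
  \<comment> \<open>Only the least claimed value counts: an untruthful entry may claim every number
    and leave none for \<open>d\<close>.\<close>
  define claim where "claim n i w \<longleftrightarrow> claims (entry n i) (conf n [n]) w \<and>
     (\<forall>u. u < w \<longrightarrow> \<not> claims (entry n i) (conf n [n]) u)" for n i w
  define d where "d n = (LEAST w. \<not> (\<exists>i. claim n i w))" for n
  have nonempty: "0 < length (\<Theta> G)" for G
  proof -
    have "\<exists>g\<in>set (\<Theta> G). (\<lambda>_. 0) \<in> nbhd (init_seg g (G g))"
      using assms unfolding SFF_def by (auto dest!: spec[of _ G] spec[of _ "\<lambda>_. 0"])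
    then show ?thesis by (auto intro: length_pos_if_in_set)
  qed
  have claim_unique: "claim n i w \<Longrightarrow> claim n i u \<Longrightarrow> u = w" for n i w u
    unfolding claim_def by (meson nat_neq_iff)
  have entry: "entry n i \<in> set (\<Theta> (bound (conf n [n])))" for n i
    unfolding entry_def using nonempty by simp
  have ex: "\<exists>w. \<not> (\<exists>i. claim n i w)" for n
  proof -
    \<comment> \<open>The claim is restated for the entry instead of its position, which bounds the
      claimed values by an image of a finite set.\<close>
    define C where "C g w \<longleftrightarrow> claims g (conf n [n]) w \<and> (\<forall>u. u < w \<longrightarrow> \<not> claims g (conf n [n]) u)" for g w
    have "{w. \<exists>i. claim n i w} \<subseteq> (\<lambda>g. THE w. C g w) ` set (\<Theta> (bound (conf n [n])))"
    proof clarify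
      fix w i assume "claim n i w"
      then have "C (entry n i) w" "\<And>u. C (entry n i) u \<Longrightarrow> u = w"
        using claim_unique unfolding claim_def C_def by blast+
      then have "(THE w. C (entry n i) w) = w" by (rule the_equality)
      then show "w \<in> (\<lambda>g. THE w. C g w) ` set (\<Theta> (bound (conf n [n])))"
        using entry by (intro rev_image_eqI) auto
    qed
    then have "finite {w. \<exists>i. claim n i w}" by (rule finite_subset) simp
    then show ?thesis using ex_new_if_finite[OF infinite_UNIV_nat] by blast
  qed
  have "kfun [\<Theta>] 1 0 (\<lambda>ns fs. d (hd ns))"
  proof -
    have entry: "kfun [\<Theta>] k 0 (\<lambda>ns fs. entry (A ns fs) (I ns fs) (B ns fs))"
      if "kfun [\<Theta>] k 0 A" "kfun [\<Theta>] k 0 I" "kfun [\<Theta>] k 0 B" for k A I B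
    proof (rule kfun_comp3[OF _ that])
      have b: "kfun [\<Theta>] 3 (Suc 0) (\<lambda>ns fs. bound (conf (hd ns) [hd ns]) (hd fs))"
        by (intro kfun_bound kc; simp)
      have "kfun [\<Theta>] 3 0 (\<lambda>ns fs. length (\<Theta> (\<lambda>f. bound (conf (hd ns) [hd ns]) (hd (f # fs)))))"
        by (rule kfun_Theta_length[OF b])
      then have len: "kfun [\<Theta>] 3 0 (\<lambda>ns fs. length (\<Theta> (bound (conf (hd ns) [hd ns]))))" by simp
      have "kfun [\<Theta>] 3 0 (\<lambda>ns fs. (\<Theta> (\<lambda>f. bound (conf (hd ns) [hd ns]) (hd (f # fs))) !
          (if hd (tl ns) < length (\<Theta> (bound (conf (hd ns) [hd ns]))) then hd (tl ns) else 0)) (hd (tl (tl ns))))"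
        by (rule kfun_Theta_entry[OF b]) (intro len kc; simp | simp add: nonempty[simplified])+
      then show "kfun [\<Theta>] 3 0 (\<lambda>ns fs. entry (hd ns) (hd (tl ns)) (hd (tl (tl ns))))"
        by (simp add: entry_def)
    qed
    show ?thesis unfolding d_def claim_def claims_def
    proof (intro kc entry)
    qed (use ex in \<open>simp_all add: claim_def claims_def\<close>)
  qed
  then obtain e where e: "\<And>ns fs. length ns = 1 \<Longrightarrow> length fs = 0 \<Longrightarrow> kleene [exists2] [\<Theta>] e ns fs (d (hd ns))"
    unfolding kfun_def by blast
  have "computable_in [exists2] [\<Theta>] d"
    unfolding computable_in_def using e[of "[n]" "[]" for n] by auto
  moreover have "\<not> computable_in [exists2] [] d"
  proof
    assume "computable_in [exists2] [] d"
    \<comment> \<open>The index of the supposed program for \<open>d\<close> serves as its argument.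
      The truthful entry for this computation claims \<open>d n\<close> and nothing else, but
      \<open>d\<close> avoids all claims.\<close>
    then obtain n where "kleene [exists2] [] n [n] [] (d n)" unfolding computable_in_def by blast
    then have "conv (conf n [n]) (d n)" by (rule kleene_conv) simp
    from SFF_entry[OF assms this] obtain g where g: "g \<in> set (\<Theta> (bound (conf n [n])))"
      "\<And>w. claims g (conf n [n]) w \<longleftrightarrow> w = d n" by blast
    then obtain i where "i < length (\<Theta> (bound (conf n [n])))" "g = entry n i"
      unfolding entry_def by (auto simp: in_set_conv_nth)
    with g have "claim n i (d n)" unfolding claim_def by auto
    moreover have "\<not> (\<exists>i. claim n i (d n))" unfolding d_def by (rule LeastI_ex[OF ex])
    ultimately show False by blast
  qed
  ultimately show ?thesis by blast
qed

end
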